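(* Let $\lambda$ be a nonzero real number and $r$ a positive integer. For every integer $k\ge 0$, as formal power series in $t$, $$\frac{1}{k!}\big(e_{\lambda}^{-1}(-t)-1\big)^{k}e_{\lambda}^{-r}(-t)=\sum_{n=k}^{\infty}H_{\lambda}^{(r)}(n+r,k+r)\frac{t^{n}}{n!}.$$
   Context: For $\lambda\in\mathbb{R}$, $\lambda\neq 0$: $(x)_{0,\lambda}=1$, $(x)_{n,\lambda}=x(x-\lambda)\cdots(x-(n-1)\lambda)$ for $n\ge 1$; $\langle x\rangle_{0,\lambda}=1$, $\langle x\rangle_{n,\lambda}=x(x+\lambda)\cdots(x+(n-1)\lambda)$ for $n\ge 1$. The falling factorial is $(x)_0=1$, $(x)_n=x(x-1)\cdots(x-n+1)$ for $n\ge 1$. The degenerate exponential is the series $e_{\lambda}^{x}(t)=\sum_{n=0}^{\infty}(x)_{n,\lambda}\frac{t^n}{n!}$ (that is, $(1+\lambda t)^{x/\lambda}$); $e_\lambda^{-r}(-t)$ denotes $e_\lambda^{x}(s)$ at $x=-r$, $s=-t$ (that is, $(1-\lambda t)^{-r/\lambda}$), and similarly for $e_\lambda^{-1}(-t)$. For a positive integer $r$, the heterogeneous $r$-Stirling numbers of the second kind $H_\lambda^{(r)}(n+r,k+r)$, $0\le k\le n$, are defined by the polynomial identity $\langle x+r\rangle_{n,\lambda}=\sum_{k=0}^{n}H_{\lambda}^{(r)}(n+r,k+r)(x)_{k}$ for $n\ge 0$. *)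

theory Defs
  imports "HOL-Computational_Algebra.Formal_Power_Series"
begin

definition falling_fact :: "real \<Rightarrow> nat \<Rightarrow> real" where
  "falling_fact x n = (\<Prod>i<n. x - real i)"

definition deg_falling_fact :: "real \<Rightarrow> real \<Rightarrow> nat \<Rightarrow> real" where
  "deg_falling_fact l x n = (\<Prod>i<n. x - real i * l)"

definition deg_rising_fact :: "real \<Rightarrow> real \<Rightarrow> nat \<Rightarrow> real" where
  "deg_rising_fact l x n = (\<Prod>i<n. x + real i * l)"

definition deg_exp :: "real \<Rightarrow> real \<Rightarrow> real fps" where
  "deg_exp l x = Abs_fps (\<lambda>n. deg_falling_fact l x n / fact n)"

text \<open>
  The defining identity determines \<open>H (n + r) (k + r)\<close> only for \<open>k \<le> n\<close>; all other
  values are set to zero, so that exactly one array satisfies the predicate.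
\<close>

definition is_het_stirling2 :: "real \<Rightarrow> nat \<Rightarrow> (nat \<Rightarrow> nat \<Rightarrow> real) \<Rightarrow> bool" where
  "is_het_stirling2 l r H \<longleftrightarrow>
     (\<forall>n x. deg_rising_fact l (x + real r) n =
        (\<Sum>k\<le>n. H (n + r) (k + r) * falling_fact x k)) \<and>
     (\<forall>N K. \<not> (r \<le> K \<and> K \<le> N) \<longrightarrow> H N K = 0)"

definition het_stirling2 :: "real \<Rightarrow> nat \<Rightarrow> nat \<Rightarrow> nat \<Rightarrow> real" where
  "het_stirling2 l r = (THE H. is_het_stirling2 l r H)"

lemma falling_fact_nat_eq_0: "m < k \<Longrightarrow> falling_fact (real m) k = 0"
  by (auto simp: falling_fact_def)

lemma falling_fact_nat_self_neq_0: "falling_fact (real m) m \<noteq> 0"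
  by (auto simp: falling_fact_def)

lemma falling_fact_coeffs_unique:
  assumes eq: "\<And>x. (\<Sum>k\<le>n. c k * falling_fact x k) = (\<Sum>k\<le>n. d k * falling_fact x k)"
    and "m \<le> n"
  shows "c m = d m"
  using \<open>m \<le> n\<close>
proof (induction m rule: less_induct)
  case (less m)
  have cut: "(\<Sum>k\<le>n. a k * falling_fact (real m) k) =
      (\<Sum>k<m. a k * falling_fact (real m) k) + a m * falling_fact (real m) m" for a
  proof -
    have "(\<Sum>k\<le>n. a k * falling_fact (real m) k) = (\<Sum>k\<le>m. a k * falling_fact (real m) k)"
      using less.prems by (intro sum.mono_neutral_right) (auto simp: falling_fact_nat_eq_0)
    also have "\<dots> = (\<Sum>k<m. a k * falling_fact (real m) k) + a m * falling_fact (real m) m"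
      by (simp flip: lessThan_Suc_atMost)
    finally show ?thesis .
  qed
  have "(\<Sum>k<m. c k * falling_fact (real m) k) = (\<Sum>k<m. d k * falling_fact (real m) k)"
    using less by (intro sum.cong) auto
  with eq[of "real m"] have "c m * falling_fact (real m) m = d m * falling_fact (real m) m"
    by (simp add: cut)
  then show ?case
    by (simp add: falling_fact_nat_self_neq_0)
qed

lemma deg_rising_fact_expansion:
  "\<exists>c. \<forall>x. deg_rising_fact l (x + real r) n = (\<Sum>k\<le>n. c k * falling_fact x k)"
proof (induction n)
  case 0
  show ?case
    by (rule exI[of _ "\<lambda>_. 1"]) (simp add: deg_rising_fact_def falling_fact_def)
next
  case (Suc n)
  then obtain c where
    c: "\<And>x. deg_rising_fact l (x + real r) n = (\<Sum>k\<le>n. c k * falling_fact x k)"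
    by blast
  define a where "a k = (if k \<le> n then c k * (real k + real r + real n * l) else 0)" for k
  define b where "b k = (case k of 0 \<Rightarrow> 0 | Suc j \<Rightarrow> c j)" for k
  have "deg_rising_fact l (x + real r) (Suc n) = (\<Sum>k\<le>Suc n. (a k + b k) * falling_fact x k)"
    for x
  proof -
    have "deg_rising_fact l (x + real r) (Suc n) =
        (\<Sum>k\<le>n. c k * falling_fact x k) * (x + real r + real n * l)"
      using c[of x] by (simp add: deg_rising_fact_def)
    also have "\<dots> = (\<Sum>k\<le>n. a k * falling_fact x k + c k * falling_fact x (Suc k))"
      unfolding sum_distrib_right
      by (intro sum.cong) (auto simp: a_def falling_fact_def algebra_simps)
    also have "\<dots> = (\<Sum>k\<le>Suc n. a k * falling_fact x k) + (\<Sum>k\<le>Suc n. b k * falling_fact x k)"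
      by (subst (2) sum.atMost_Suc_shift) (simp add: sum.distrib a_def b_def)
    finally show ?thesis
      by (simp add: sum.distrib algebra_simps)
  qed
  then show ?case
    by (intro exI[of _ "\<lambda>k. a k + b k"] allI)
qed

lemma is_het_stirling2_unique:
  assumes "is_het_stirling2 l r H" "is_het_stirling2 l r H'"
  shows "H = H'"
proof (intro ext)
  fix N K
  show "H N K = H' N K"
  proof (cases "r \<le> K \<and> K \<le> N")
    case True
    define k n where "k = K - r" and "n = N - r"
    with True have "K = k + r" "N = n + r" "k \<le> n"
      by auto
    moreover have "H (n + r) (k + r) = H' (n + r) (k + r)"
    proof (rule falling_fact_coeffs_unique[OF _ \<open>k \<le> n\<close>])
      fix x
      show "(\<Sum>k\<le>n. H (n + r) (k + r) * falling_fact x k) =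
          (\<Sum>k\<le>n. H' (n + r) (k + r) * falling_fact x k)"
        using assms unfolding is_het_stirling2_def by (metis (no_types))
    qed
    ultimately show ?thesis
      by simp
  next
    case False
    then show ?thesis
      using assms by (simp add: is_het_stirling2_def)
  qed
qed

lemma is_het_stirling2_exists: "\<exists>H. is_het_stirling2 l r H"
proof -
  have "\<forall>n. \<exists>c. \<forall>x. deg_rising_fact l (x + real r) n = (\<Sum>k\<le>n. c k * falling_fact x k)"
    using deg_rising_fact_expansion by (rule allI)
  from choice[OF this] obtain c where
    c: "\<forall>n x. deg_rising_fact l (x + real r) n = (\<Sum>k\<le>n. c n k * falling_fact x k)" ..
  have "is_het_stirling2 l r (\<lambda>N K. if r \<le> K \<and> K \<le> N then c (N - r) (K - r) else 0)"
    unfolding is_het_stirling2_def using c by auto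
  then show ?thesis
    by blast
qed

lemma is_het_stirling2_het_stirling2: "is_het_stirling2 l r (het_stirling2 l r)"
  unfolding het_stirling2_def
  by (rule theI'[of "is_het_stirling2 l r"], rule ex_ex1I,
      rule is_het_stirling2_exists, rule is_het_stirling2_unique)

end

theory Submission
  imports Defs
begin

text \<open>
  Write \<open>E x\<close> for the series $e_\lambda^{-x}(-t)$, whose coefficients are the degenerate rising
  factorials of \<open>x\<close>. Since \<open>E (x + y) = E x * E y\<close>, expanding \<open>E 1 ^ m = (1 + (E 1 - 1)) ^ m\<close>
  binomially writes the coefficients of \<open>E (m + r) = E 1 ^ m * E r\<close> as combinations of falling
  factorials of \<open>m\<close>. These agree with the defining expansion of \<open>H\<close> at every natural
  number \<open>m\<close>, which already determines the coefficients.
\<close>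

unbundle fps_syntax

text \<open>Evaluating at 0, 1, ..., n gives a triangular system with nonzero diagonal, because
  \<open>falling_fact (real m) k\<close> vanishes for k > m. Natural arguments must suffice here,
  since the binomial expansion is only available there.\<close>

lemma falling_fact_coeffs_unique_nat:
  assumes eq: "\<And>m :: nat. (\<Sum>k\<le>n. c k * falling_fact (real m) k) =
      (\<Sum>k\<le>n. d k * falling_fact (real m) k)"
    and "m \<le> n"
  shows "c m = d m"
  using \<open>m \<le> n\<close>
proof (induction m rule: less_induct)
  case (less m)
  have cut: "(\<Sum>k\<le>n. a k * falling_fact (real m) k) =
      (\<Sum>k<m. a k * falling_fact (real m) k) + a m * falling_fact (real m) m" for a
  proof -
    have "(\<Sum>k\<le>n. a k * falling_fact (real m) k) = (\<Sum>k\<le>m. a k * falling_fact (real m) k)"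
      using less.prems by (intro sum.mono_neutral_right) (auto simp: falling_fact_nat_eq_0)
    then show ?thesis
      by (simp flip: lessThan_Suc_atMost)
  qed
  have "(\<Sum>k<m. c k * falling_fact (real m) k) = (\<Sum>k<m. d k * falling_fact (real m) k)"
    using less by (intro sum.cong) auto
  with eq[of m] show ?case
    by (simp add: cut falling_fact_nat_self_neq_0)
qed

lemma falling_fact_of_nat: "falling_fact (real m) k = fact k * real (m choose k)"
  by (simp add: falling_fact_def binomial_gbinomial gbinomial_mult_fact atLeast0LessThan)

text \<open>Substituting -t contributes one sign per factor, which turns each factor -x - i*l into x
  + i*l.\<close>

lemma deg_exp_compose_uminus_nth:
  "(deg_exp l (- x) oo (- fps_X)) $ n = deg_rising_fact l x n / fact n"
proof -
  have "(deg_exp l (- x) oo (- fps_X)) $ n = (- 1) ^ n * deg_falling_fact l (- x) n / fact n"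
    by (simp add: deg_exp_def fps_compose_uminus')
  also have "(- 1) ^ n * deg_falling_fact l (- x) n = (\<Prod>i<n. (- 1) * (- x - real i * l))"
    unfolding deg_falling_fact_def prod.distrib by simp
  finally show ?thesis
    by (simp add: deg_rising_fact_def add.commute)
qed

text \<open>Pulling l out of every factor identifies the series with (1 + l*t)^(x/l), so the
  exponent law can be inherited from \<open>fps_binomial\<close>.\<close>

lemma deg_exp_eq_fps_binomial:
  assumes "l \<noteq> 0"
  shows "deg_exp l x = fps_binomial (x / l) oo (fps_const l * fps_X)"
proof (rule fps_ext)
  fix n
  have "deg_falling_fact l x n = (\<Prod>i<n. l * (x / l - real i))"
    using assms by (simp add: deg_falling_fact_def algebra_simps)
  also have "\<dots> = l ^ n * (\<Prod>i<n. x / l - real i)"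
    by (simp add: prod.distrib)
  finally show "deg_exp l x $ n = (fps_binomial (x / l) oo (fps_const l * fps_X)) $ n"
    by (simp add: deg_exp_def fps_compose_linear gbinomial_prod_rev atLeast0LessThan)
qed

lemma deg_exp_add:
  assumes "l \<noteq> 0"
  shows "deg_exp l (x + y) = deg_exp l x * deg_exp l y"
  using assms
  by (simp add: deg_exp_eq_fps_binomial add_divide_distrib fps_binomial_add_mult
      fps_compose_mult_distrib)

lemma deg_exp_of_nat_mult:
  assumes "l \<noteq> 0"
  shows "deg_exp l (real m * x) = deg_exp l x ^ m"
proof (induction m)
  case 0
  show ?case
    using assms by (simp add: deg_exp_eq_fps_binomial)
next
  case (Suc m)
  then show ?case
    using assms by (simp add: distrib_right deg_exp_add)
qed

theorem mainTheorem12: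
  fixes l :: real and r k :: nat
  assumes "l \<noteq> 0" and "r \<ge> 1"
  shows "fps_const (1 / fact k) * ((deg_exp l (- 1) oo (- fps_X)) - 1) ^ k
           * (deg_exp l (- real r) oo (- fps_X))
         = Abs_fps (\<lambda>n. if k \<le> n then het_stirling2 l r (n + r) (k + r) / fact n else 0)"
proof (rule fps_ext)
  fix n
  define E where "E x = deg_exp l (- x) oo (- fps_X)" for x
  define G where "G j = (E 1 - 1) ^ j * E (real r)" for j
  have E_nth: "E x $ i = deg_rising_fact l x i / fact i" for x i
    by (simp add: E_def deg_exp_compose_uminus_nth)
  \<comment> \<open>\<open>E 1\<close> has constant term 1, so the j-th power of
    \<open>E 1 - 1\<close> starts no earlier than t^j.\<close>
  have G_nth_eq_0: "G j $ i = 0" if "i < j" for i j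
  proof -
    have "(E 1 - 1) ^ j $ a = 0" if "a < j" for a
      using that by (intro startsby_zero_power_prefix[rule_format]) (auto simp: E_nth deg_rising_fact_def)
    then show ?thesis
      using that by (simp add: G_def fps_mult_nth)
  qed
  have E_expand: "E (real m + real r) = (\<Sum>j\<le>m. of_nat (m choose j) * G j)" for m
  proof -
    have "E (real m + real r) = E 1 ^ m * E (real r)"
      using deg_exp_add[OF assms(1), of "real m * (- 1)" "- real r"]
        deg_exp_of_nat_mult[OF assms(1), of m "- 1"]
      by (simp add: E_def fps_compose_mult_distrib fps_compose_power)
    also have "E 1 ^ m = ((E 1 - 1) + 1) ^ m"
      by simp
    also have "\<dots> = (\<Sum>j\<le>m. of_nat (m choose j) * (E 1 - 1) ^ j)"
      by (subst binomial_ring) simp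
    finally show ?thesis
      by (simp add: G_def sum_distrib_right mult.assoc)
  qed
  have H: "is_het_stirling2 l r (het_stirling2 l r)"
    by (rule is_het_stirling2_het_stirling2)
  \<comment> \<open>The factor 1/j! is cancelled by \<open>falling_fact (real m) j\<close>, which is
    j! times a binomial coefficient.\<close>
  have coeff: "het_stirling2 l r (n + r) (j + r) = fact n / fact j * G j $ n" if "j \<le> n" for j
  proof (rule falling_fact_coeffs_unique_nat[OF _ that])
    fix m :: nat
    have "(\<Sum>j\<le>n. het_stirling2 l r (n + r) (j + r) * falling_fact (real m) j) =
        fact n * E (real m + real r) $ n"
      using H by (simp add: is_het_stirling2_def E_nth)
    also have "E (real m + real r) $ n = (\<Sum>j\<le>m. real (m choose j) * G j $ n)"
      by (simp add: E_expand fps_sum_nth fps_of_nat[symmetric] del: fps_of_nat)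
    \<comment> \<open>The range passes from m to n through a common upper bound: terms with j > m
      have zero binomial coefficient, and terms with j > n vanish by
      \<open>G_nth_eq_0\<close>.\<close>
    also have "\<dots> = (\<Sum>j\<le>max m n. real (m choose j) * G j $ n)"
      by (intro sum.mono_neutral_left) auto
    also have "\<dots> = (\<Sum>j\<le>n. real (m choose j) * G j $ n)"
      by (intro sum.mono_neutral_right) (auto simp: G_nth_eq_0)
    finally show "(\<Sum>j\<le>n. het_stirling2 l r (n + r) (j + r) * falling_fact (real m) j) =
        (\<Sum>j\<le>n. fact n / fact j * G j $ n * falling_fact (real m) j)"
      by (simp add: sum_distrib_left falling_fact_of_nat mult_ac)
  qed
  have "(fps_const (1 / fact k) * (E 1 - 1) ^ k * E (real r)) $ n = G k $ n / fact k"
    by (simp add: G_def mult.assoc)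
  \<comment> \<open>For k > n the default 0 on the right matches the vanishing of
    \<open>G k $ n\<close>; otherwise \<open>coeff\<close> applies and \<open>fact n\<close>
    cancels.\<close>
  then show "(fps_const (1 / fact k) * ((deg_exp l (- 1) oo (- fps_X)) - 1) ^ k
           * (deg_exp l (- real r) oo (- fps_X))) $ n
         = Abs_fps (\<lambda>n. if k \<le> n then het_stirling2 l r (n + r) (k + r) / fact n else 0) $ n"
    by (auto simp: E_def[symmetric] coeff G_nth_eq_0)
qed

end
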